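(* Let $G=(V,E,w)$ be a finite weighted directed graph with nonempty boundary $\partial V$. Let $f(x,\mathbf{p})$, defined for $x\in V\setminus\partial V$ and $\mathbf{p}\in\mathbb{R}^{d(x)}$, be real-valued, elliptic and homogeneous, and suppose that $f$ is continuous in $\mathbf{p}$ for each $x$. Then for every $g:\partial V\to\mathbb{R}$ the Dirichlet problem has a solution: there exists $u:V\to\mathbb{R}$ such that $f(x,\nabla u(x))=0$ for all $x\in V\setminus\partial V$ and $u(x)=g(x)$ for all $x\in\partial V$.
   Context: $G=(V,E,w)$ is a finite weighted directed graph: $V$ is a finite set of vertices, $E\subset V\times V$ is a set of oriented edges $e_{xy}=(x,y)$ from $x$ to $y$, and $w$ assigns a weight $w_{xy}>0$ to each edge $e_{xy}$ joining different vertices. A nonempty subset $\partial V\subset V$ is fixed, called the boundary; vertices of $V\setminus\partial V$ are called interior. A vertex $y\neq x$ is a neighbor of $x$ if there is an edge from $x$ to $y$; $d(x)$ is the number of neighbors of $x$, and it is assumed that $d(x)\ge 1$ for every interior $x$. For each $x$ an ordering $y_1,\dots,y_{d(x)}$ of the neighbors of $x$ is fixed. For $u:V\to\mathbb{R}$ and interior $x$, the gradient is $\nabla u(x)=\big(w_{xy_1}(u(y_1)-u(x)),\dots,w_{xy_{d(x)}}(u(y_{d(x)})-u(x))\big)\in\mathbb{R}^{d(x)}$. For vectors, $\mathbf{p}\le\mathbf{q}$ means $p_i\le q_i$ for all $i$; $\min(\mathbf{p})$ and $\max(\mathbf{p})$ denote the smallest and largest components. $f$ is elliptic if $\mathbf{p}\le\mathbf{q}$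 implies $f(x,\mathbf{p})\le f(x,\mathbf{q})$ for all interior $x$ and $\mathbf{p},\mathbf{q}\in\mathbb{R}^{d(x)}$. An elliptic $f$ is homogeneous if there is a function $w_0:V\setminus\partial V\to[0,\infty)$ with $w_0(x)\min(\mathbf{p})\le f(x,\mathbf{p})\le w_0(x)\max(\mathbf{p})$ for all interior $x$ and all $\mathbf{p}\in\mathbb{R}^{d(x)}$. *)

theory Defs
  imports "HOL-Analysis.Analysis"
begin

text \<open>Self-loops are allowed as edges, but a vertex is never a neighbor of itself.\<close>

definition neighbors :: "('v \<times> 'v) set \<Rightarrow> 'v \<Rightarrow> 'v set" where
  "neighbors E x = {y. y \<noteq> x \<and> (x, y) \<in> E}"

definition num_neighbors :: "('v \<times> 'v) set \<Rightarrow> 'v \<Rightarrow> nat" where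
  "num_neighbors E x = card (neighbors E x)"

text \<open>The argument \<open>nbr\<close> is the fixed ordering: \<open>nbr x i\<close> is the \<open>i\<close>-th neighbor of \<open>x\<close>,
  for \<open>1 \<le> i \<le> num_neighbors E x\<close>. Values of \<open>w\<close> outside the non-loop edges are irrelevant.\<close>

locale weighted_digraph_with_boundary =
  fixes V :: "'v set"
    and E :: "('v \<times> 'v) set"
    and w :: "'v \<Rightarrow> 'v \<Rightarrow> real"
    and bd :: "'v set"
    and nbr :: "'v \<Rightarrow> nat \<Rightarrow> 'v"
  assumes finite_vertices: "finite V"
    and edges_subset: "E \<subseteq> V \<times> V"
    and weight_pos: "\<And>x y. (x, y) \<in> E \<Longrightarrow> x \<noteq> y \<Longrightarrow> w x y > 0"
    and boundary_subset: "bd \<subseteq> V"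
    and boundary_nonempty: "bd \<noteq> {}"
    and interior_degree: "\<And>x. x \<in> V - bd \<Longrightarrow> num_neighbors E x \<ge> 1"
    and neighbor_ordering:
      "\<And>x. x \<in> V \<Longrightarrow> bij_betw (nbr x) {1..num_neighbors E x} (neighbors E x)"

text \<open>Since the dimension varies with the vertex, the space of real \<open>n\<close>-vectors is represented by
  the functions on \<open>{1..n}\<close> that are \<open>undefined\<close> elsewhere. The topology it inherits from the
  product topology on \<^typ>\<open>nat \<Rightarrow> real\<close> is the Euclidean one.\<close>

definition vecs :: "nat \<Rightarrow> (nat \<Rightarrow> real) set" where
  "vecs n = {1..n} \<rightarrow>\<^sub>E UNIV"

definition vec_le :: "nat \<Rightarrow> (nat \<Rightarrow> real) \<Rightarrow> (nat \<Rightarrow> real) \<Rightarrow> bool" where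
  "vec_le n p q \<longleftrightarrow> (\<forall>i\<in>{1..n}. p i \<le> q i)"

definition vec_min :: "nat \<Rightarrow> (nat \<Rightarrow> real) \<Rightarrow> real" where
  "vec_min n p = Min (p ` {1..n})"

definition vec_max :: "nat \<Rightarrow> (nat \<Rightarrow> real) \<Rightarrow> real" where
  "vec_max n p = Max (p ` {1..n})"

definition gradient ::
  "('v \<times> 'v) set \<Rightarrow> ('v \<Rightarrow> 'v \<Rightarrow> real) \<Rightarrow> ('v \<Rightarrow> nat \<Rightarrow> 'v) \<Rightarrow> ('v \<Rightarrow> real) \<Rightarrow> 'v \<Rightarrow> nat \<Rightarrow> real" where
  "gradient E w nbr u x = (\<lambda>i\<in>{1..num_neighbors E x}. w x (nbr x i) * (u (nbr x i) - u x))"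

definition elliptic ::
  "'v set \<Rightarrow> ('v \<times> 'v) set \<Rightarrow> 'v set \<Rightarrow> ('v \<Rightarrow> (nat \<Rightarrow> real) \<Rightarrow> real) \<Rightarrow> bool" where
  "elliptic V E bd f \<longleftrightarrow>
    (\<forall>x\<in>V - bd. \<forall>p\<in>vecs (num_neighbors E x). \<forall>q\<in>vecs (num_neighbors E x).
      vec_le (num_neighbors E x) p q \<longrightarrow> f x p \<le> f x q)"

definition homogeneous ::
  "'v set \<Rightarrow> ('v \<times> 'v) set \<Rightarrow> 'v set \<Rightarrow> ('v \<Rightarrow> (nat \<Rightarrow> real) \<Rightarrow> real) \<Rightarrow> bool" where
  "homogeneous V E bd f \<longleftrightarrow>
    (\<exists>w\<^sub>0 :: 'v \<Rightarrow> real. \<forall>x\<in>V - bd. w\<^sub>0 x \<ge> 0 \<and>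
      (\<forall>p\<in>vecs (num_neighbors E x).
        w\<^sub>0 x * vec_min (num_neighbors E x) p \<le> f x p \<and> f x p \<le> w\<^sub>0 x * vec_max (num_neighbors E x) p))"

end

theory Submission
  imports Defs
begin

text \<open>
  The proof is Perron's method. Write \<open>F x u = f x (\<nabla>u(x))\<close>. Since the weights are positive and \<open>f\<close> is
  elliptic, \<open>F x u\<close> is nondecreasing in the values of \<open>u\<close> away from \<open>x\<close>, and it is continuous in the
  value \<open>u x\<close>. Let \<open>U\<close> be the pointwise supremum of all subsolutions (\<open>F x u \<ge> 0\<close> in the interior)
  that lie between a fixed subsolution and a fixed supersolution. Monotonicity and continuity make
  \<open>U\<close> itself a subsolution. If \<open>F x U > 0\<close> held at some interior \<open>x\<close>, raising \<open>U\<close> slightly at \<open>x\<close>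
  alone would keep the inequality at \<open>x\<close> and could only increase \<open>F y U\<close> at the other interior vertices
  \<open>y\<close>, producing a larger subsolution below the supersolution; so \<open>F x U = 0\<close>. This is lemma \<open>perron_method\<close>.

  Homogeneity supplies the two barriers: it forces \<open>f x 0 = 0\<close>, so extending \<open>g\<close> to the
  interior by a lower bound of \<open>g\<close> gives a subsolution (all gradients are nonnegative there), and
  extending it by an upper bound gives a supersolution. Both equal \<open>g\<close> on the boundary, so the
  solution squeezed between them does too.
\<close>

text \<open>Stated for an arbitrary family of scalar equations \<open>F x u = 0\<close>, \<open>x \<in> I\<close>, since only the
  monotone coupling between the unknowns matters. Equality \<open>u x = v x\<close> in the monotonicity
  hypothesis reflects that \<open>F x\<close> may decrease in the unknown at \<open>x\<close> itself.\<close>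

lemma perron_method:
  fixes F :: "'a \<Rightarrow> ('a \<Rightarrow> real) \<Rightarrow> real"
  assumes mono: "\<And>x u v. x \<in> I \<Longrightarrow> u \<le> v \<Longrightarrow> u x = v x \<Longrightarrow> F x u \<le> F x v"
    and cont: "\<And>x u. x \<in> I \<Longrightarrow> continuous_on UNIV (\<lambda>t. F x (u(x := t)))"
    and sub: "\<And>x. x \<in> I \<Longrightarrow> 0 \<le> F x a"
    and super: "\<And>x. x \<in> I \<Longrightarrow> F x b \<le> 0"
    and "a \<le> b"
  shows "\<exists>u. a \<le> u \<and> u \<le> b \<and> (\<forall>x\<in>I. F x u = 0)"
proof -
  define S where "S = {u. a \<le> u \<and> u \<le> b \<and> (\<forall>x\<in>I. 0 \<le> F x u)}"
  define U where "U x = (SUP u\<in>S. u x)" for x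
  have aS: "a \<in> S"
    using sub \<open>a \<le> b\<close> by (auto simp: S_def)
  have bdd: "bdd_above ((\<lambda>u. u x) ` S)" for x
    by (rule bdd_aboveI[of _ "b x"]) (auto simp: S_def le_fun_def)
  have upper: "u \<le> U" if "u \<in> S" for u
    unfolding le_fun_def U_def using that bdd by (auto intro: cSUP_upper)
  have "U \<le> b"
    unfolding le_fun_def U_def using aS by (auto intro!: cSUP_least simp: S_def le_fun_def)
  have U_sub: "0 \<le> F x U" if x: "x \<in> I" for x
  proof -
    \<comment> \<open>Freeze the other unknowns at \<open>U\<close>: by monotonicity the value \<open>u x\<close> of every \<open>u\<close> in \<open>S\<close> is
      then still admissible at \<open>x\<close>, and closedness passes this on to the supremum.\<close>
    let ?C = "{t. 0 \<le> F x (U(x := t))}"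
    have "closed ?C"
      using cont[OF x] by (intro closed_Collect_le) auto
    moreover have "(\<lambda>u. u x) ` S \<subseteq> ?C"
    proof clarsimp
      fix u assume u: "u \<in> S"
      have "0 \<le> F x u"
        using u x by (auto simp: S_def)
      also have "\<dots> \<le> F x (U(x := u x))"
        using upper[OF u] x by (intro mono) (auto simp: le_fun_def)
      finally show "0 \<le> F x (U(x := u x))" .
    qed
    ultimately have "U x \<in> ?C"
      unfolding U_def using aS bdd closed_subset_contains_Sup by blast
    then show ?thesis by simp
  qed
  have "F x U \<le> 0" if x: "x \<in> I" for x
  proof (rule ccontr)
    assume pos: "\<not> F x U \<le> 0"
    \<comment> \<open>If \<open>U\<close> touched the supersolution at \<open>x\<close>, monotonicity would give \<open>F x U \<le> F x b \<le> 0\<close>;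
      hence there is room to raise \<open>U\<close> at \<open>x\<close>.\<close>
    have "U x \<noteq> b x"
      using mono[OF x \<open>U \<le> b\<close>] super[OF x] pos by auto
    with \<open>U \<le> b\<close> have "U x < b x"
      by (simp add: le_fun_def order_less_le)
    have "open {t. 0 < F x (U(x := t))}"
      using cont[OF x] by (intro open_Collect_less) auto
    moreover have "U x \<in> {t. 0 < F x (U(x := t))}"
      using pos by simp
    ultimately obtain c where "U x < c" and c: "{U x..<c} \<subseteq> {t. 0 < F x (U(x := t))}"
      using open_right[of _ "U x" "b x"] \<open>U x < b x\<close> by blast
    obtain t where t: "U x < t" "t < c" "t < b x"
      using dense[of "U x" "min c (b x)"] \<open>U x < c\<close> \<open>U x < b x\<close> by auto
    let ?u = "U(x := t)"
    have "U \<le> ?u"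
      using t by (auto simp: le_fun_def)
    have "0 \<le> F y ?u" if y: "y \<in> I" for y
    proof (cases "y = x")
      case True
      have "t \<in> {U x..<c}"
        using t by simp
      then show ?thesis
        using c True by fastforce
    next
      case False
      then show ?thesis
        using U_sub[OF y] mono[OF y \<open>U \<le> ?u\<close>] by simp
    qed
    moreover have "?u \<le> b"
      using \<open>U \<le> b\<close> t by (auto simp: le_fun_def)
    ultimately have "?u \<in> S"
      using upper[OF aS] \<open>U \<le> ?u\<close> by (auto simp: S_def)
    then have "t \<le> U x"
      using upper[of ?u] by (auto simp: le_fun_def dest!: spec[of _ x])
    with t show False by simp
  qed
  then show ?thesis
    using U_sub upper[OF aS] \<open>U \<le> b\<close> by (intro exI[of _ U]) (auto intro: antisym)
qed

context weighted_digraph_with_boundary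
begin

lemma gradient_in_vecs: "gradient E w nbr u x \<in> vecs (num_neighbors E x)"
  by (auto simp: gradient_def vecs_def)

lemma nbr_props:
  assumes "x \<in> V - bd" "i \<in> {1..num_neighbors E x}"
  shows "nbr x i \<noteq> x" and "0 < w x (nbr x i)"
proof -
  have "nbr x i \<in> neighbors E x"
    using neighbor_ordering[of x] assms by (auto dest: bij_betwE)
  then show "nbr x i \<noteq> x" "0 < w x (nbr x i)"
    using weight_pos[of x "nbr x i"] by (auto simp: neighbors_def)
qed

lemma vec_le_gradient:
  assumes "x \<in> V - bd" and "\<And>y. u y - u x \<le> v y - v x"
  shows "vec_le (num_neighbors E x) (gradient E w nbr u x) (gradient E w nbr v x)"
  using assms nbr_props(2)[OF assms(1)]
  by (auto simp: vec_le_def gradient_def intro!: mult_left_mono less_imp_le)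

text \<open>No neighbor of \<open>x\<close> is \<open>x\<close> itself, so every component of the gradient is affine in \<open>u x\<close>.\<close>

lemma continuous_gradient_at_vertex:
  assumes "x \<in> V - bd"
  shows "continuous_on UNIV (\<lambda>t. gradient E w nbr (u(x := t)) x)"
proof (rule continuous_on_coordinatewise_then_product)
  fix i
  show "continuous_on UNIV (\<lambda>t. gradient E w nbr (u(x := t)) x i)"
    using nbr_props(1)[OF assms]
    by (cases "i \<in> {1..num_neighbors E x}")
      (auto simp: gradient_def intro!: continuous_intros)
qed

text \<open>Both bounds of homogeneity collapse to \<open>0\<close> on a zero gradient, because an interior vertex has
  a neighbor; without one the minimum and maximum would be taken over the empty set.\<close>

lemma homogeneous_gradient_const:
  assumes "homogeneous V E bd f" "x \<in> V - bd"
  shows "f x (gradient E w nbr (\<lambda>_. c) x) = 0"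
proof -
  let ?n = "num_neighbors E x" and ?p = "gradient E w nbr (\<lambda>_. c) x"
  have "?p ` {1..?n} = {0}"
    using interior_degree[OF assms(2)] by (force simp: gradient_def image_def)
  then have "vec_min ?n ?p = 0" "vec_max ?n ?p = 0"
    by (simp_all add: vec_min_def vec_max_def)
  moreover obtain w0 where
    "w0 * vec_min ?n ?p \<le> f x ?p" "f x ?p \<le> w0 * vec_max ?n ?p"
    using assms gradient_in_vecs[of "\<lambda>_. c" x] unfolding homogeneous_def by blast
  ultimately show ?thesis by simp
qed

end

theorem theorem5:
  fixes V :: "'v set"
    and E :: "('v \<times> 'v) set"
    and w :: "'v \<Rightarrow> 'v \<Rightarrow> real"
    and bd :: "'v set"
    and nbr :: "'v \<Rightarrow> nat \<Rightarrow> 'v"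
    and f :: "'v \<Rightarrow> (nat \<Rightarrow> real) \<Rightarrow> real"
    and g :: "'v \<Rightarrow> real"
  assumes "weighted_digraph_with_boundary V E w bd nbr"
    and "elliptic V E bd f"
    and "homogeneous V E bd f"
    and "\<And>x. x \<in> V - bd \<Longrightarrow> continuous_on (vecs (num_neighbors E x)) (f x)"
  shows "\<exists>u :: 'v \<Rightarrow> real.
    (\<forall>x\<in>V - bd. f x (gradient E w nbr u x) = 0) \<and> (\<forall>x\<in>bd. u x = g x)"
proof -
  interpret weighted_digraph_with_boundary V E w bd nbr
    by (fact assms(1))
  let ?F = "\<lambda>x u. f x (gradient E w nbr u x)"
  have mono: "?F x u \<le> ?F x v"
    if "x \<in> V - bd" "\<And>y. u y - u x \<le> v y - v x" for x u v
    using assms(2) that(1) vec_le_gradient[of x u v, OF that] gradient_in_vecs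
    unfolding elliptic_def by blast
  have cont: "continuous_on UNIV (\<lambda>t. ?F x (u(x := t)))" if "x \<in> V - bd" for x u
    using gradient_in_vecs
    by (intro continuous_on_compose2[OF assms(4)[OF that] continuous_gradient_at_vertex[OF that]])
      auto
  have "finite bd"
    using finite_vertices boundary_subset by (rule finite_subset[rotated])
  define m where "m = Min (g ` bd)"
  define M where "M = Max (g ` bd)"
  have g: "m \<le> g y" "g y \<le> M" if "y \<in> bd" for y
    using \<open>finite bd\<close> that by (auto simp: m_def M_def)
  have "m \<le> M"
    using g boundary_nonempty by (meson all_not_in_conv order_trans)
  define a where "a y = (if y \<in> bd then g y else m)" for y
  define b where "b y = (if y \<in> bd then g y else M)" for y
  have a_sub: "0 \<le> ?F x a" if x: "x \<in> V - bd" for x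
    using mono[OF x, of "\<lambda>_. m" a] homogeneous_gradient_const[OF assms(3) x, of m] x g
    by (auto simp: a_def)
  have b_super: "?F x b \<le> 0" if x: "x \<in> V - bd" for x
    using mono[OF x, of b "\<lambda>_. M"] homogeneous_gradient_const[OF assms(3) x, of M] x g
    by (auto simp: b_def)
  have "a \<le> b"
    using \<open>m \<le> M\<close> by (auto simp: a_def b_def le_fun_def)
  have "\<exists>u. a \<le> u \<and> u \<le> b \<and> (\<forall>x\<in>V - bd. ?F x u = 0)"
    by (rule perron_method[OF _ cont a_sub b_super \<open>a \<le> b\<close>])
      (auto intro!: mono simp: le_fun_def)
  then obtain u where u: "a \<le> u" "u \<le> b" "\<forall>x\<in>V - bd. ?F x u = 0"
    by blast
  have "u x = g x" if "x \<in> bd" for x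
    using le_funD[OF u(1), of x] le_funD[OF u(2), of x] that by (simp add: a_def b_def)
  with u(3) show ?thesis by blast
qed

end
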